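(* Let $G$ be a countable group. The following are equivalent: (1) $G$ is infinite and locally finite; (2) $\mathcal{E}^\star(G)$ has a continuous map onto the Stone-Čech boundary of $\mathbf{N}$; (3) $\mathcal{E}^\star(G)$ has a family of $2^{\aleph_0}$ pairwise disjoint nonempty open subsets; (4) $\mathcal{E}^\star(G)$ does not have countable cellularity; (5) $\mathcal{E}^\star(G)$ is not separable.
   Context: A subset $A$ of a group $G$ is left $G$-commensurated if $gA\bigtriangleup A$ is finite for every $g\in G$. These subsets form a Boolean subalgebra $\mathcal{P}_{(G)}(G)$ of the power set of $G$; $\mathcal{P}^\star_G(G)$ denotes its quotient by the ideal of finite subsets of $G$. The space of ends $\mathcal{E}^\star(G)$ is the Stone dual of $\mathcal{P}^\star_G(G)$, i.e. the compact Hausdorff totally disconnected space whose Boolean algebra of clopen subsets is $\mathcal{P}^\star_G(G)$ (empty if $G$ is finite). "Onto" means surjective. The Stone-Čech boundary of $\mathbf{N}$ is $\beta\mathbf{N}\smallsetminus\mathbf{N}$. A group is locally finite if all its finitely generated subgroups are finite. The cellularity of a topological space is the supremum of the cardinals of families of pairwise disjoint nonempty open subsets; the space has countable cellularity if its cellularity is $\le\aleph_0$. *)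

theory Defs
  imports "HOL-Algebra.Generated_Groups" "HOL-Analysis.Analysis"
begin

unbundle cardinal_syntax


section \<open>Locally finite groups\<close>

definition locally_finite_group :: "('a, 'b) monoid_scheme \<Rightarrow> bool" where
  "locally_finite_group G \<longleftrightarrow>
     group G \<and> (\<forall>S. S \<subseteq> carrier G \<longrightarrow> finite S \<longrightarrow> finite (generate G S))"


section \<open>Stone duals of Boolean algebras\<close>

text \<open>
  A Boolean algebra is presented by its order, as a partially ordered carrier whose
  equality is the equality of the logic. Filters are taken in the order-theoretic sense:
  since binary meets exist, a nonempty up-closed set is down-directed iff it is closed under
  meets.
\<close>

definition order_filter :: "'a gorder \<Rightarrow> 'a set \<Rightarrow> bool" where
  "order_filter L F \<longleftrightarrow>
     F \<subseteq> carrier L \<and> F \<noteq> {} \<and>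
     (\<forall>x\<in>F. \<forall>y\<in>carrier L. x \<sqsubseteq>\<^bsub>L\<^esub> y \<longrightarrow> y \<in> F) \<and>
     (\<forall>x\<in>F. \<forall>y\<in>F. \<exists>z\<in>F. z \<sqsubseteq>\<^bsub>L\<^esub> x \<and> z \<sqsubseteq>\<^bsub>L\<^esub> y)"

definition proper_filter :: "'a gorder \<Rightarrow> 'a set \<Rightarrow> bool" where
  "proper_filter L F \<longleftrightarrow> order_filter L F \<and> F \<noteq> carrier L"

definition is_ultrafilter :: "'a gorder \<Rightarrow> 'a set \<Rightarrow> bool" where
  "is_ultrafilter L U \<longleftrightarrow>
     proper_filter L U \<and> (\<forall>F. proper_filter L F \<longrightarrow> U \<subseteq> F \<longrightarrow> F = U)"

text \<open>
  The Stone topology; the underlying set consists of all ultrafilters, because every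
  ultrafilter has an element. The dual of a one-element algebra is empty.
\<close>

definition stone_dual :: "'a gorder \<Rightarrow> 'a set topology" where
  "stone_dual L =
     topology_generated_by ((\<lambda>a. {U. is_ultrafilter L U \<and> a \<in> U}) ` carrier L)"

lemma topspace_stone_dual: "topspace (stone_dual L) = {U. is_ultrafilter L U}"
proof -
  have "U \<subseteq> carrier L \<and> U \<noteq> {}" if "is_ultrafilter L U" for U
    using that by (simp add: is_ultrafilter_def proper_filter_def order_filter_def)
  then show ?thesis
    unfolding stone_dual_def topology_generated_by_topspace by blast
qed


section \<open>The space of ends of a group\<close>

text \<open>Here \<open>g <#\<^bsub>G\<^esub> A\<close> is the left translate \<open>gA\<close>.\<close>

definition left_commensurated :: "('a, 'b) monoid_scheme \<Rightarrow> 'a set set" where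
  "left_commensurated G =
     {A. A \<subseteq> carrier G \<and> (\<forall>g\<in>carrier G. finite (sym_diff (g <#\<^bsub>G\<^esub> A) A))}"

definition mod_finite :: "('a, 'b) monoid_scheme \<Rightarrow> ('a set \<times> 'a set) set" where
  "mod_finite G =
     {(A, B). A \<in> left_commensurated G \<and> B \<in> left_commensurated G \<and> finite (sym_diff A B)}"

text \<open>The quotient Boolean algebra, with the image of the inclusion order.\<close>

definition ends_algebra :: "('a, 'b) monoid_scheme \<Rightarrow> 'a set set gorder" where
  "ends_algebra G =
     \<lparr> carrier = left_commensurated G // mod_finite G,
       eq = (=),
       le = (\<lambda>X Y. \<exists>A\<in>X. \<exists>B\<in>Y. A \<subseteq> B) \<rparr>"

definition space_of_ends :: "('a, 'b) monoid_scheme \<Rightarrow> 'a set set set topology" where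
  "space_of_ends G = stone_dual (ends_algebra G)"

lemma left_commensurated_subalgebra:
  assumes "group G"
  shows "{} \<in> left_commensurated G"
    and "carrier G \<in> left_commensurated G"
    and "A \<in> left_commensurated G \<Longrightarrow> carrier G - A \<in> left_commensurated G"
    and "\<lbrakk>A \<in> left_commensurated G; B \<in> left_commensurated G\<rbrakk> \<Longrightarrow> A \<union> B \<in> left_commensurated G"
    and "\<lbrakk>A \<in> left_commensurated G; B \<in> left_commensurated G\<rbrakk> \<Longrightarrow> A \<inter> B \<in> left_commensurated G"
proof -
  interpret group G by fact
  have tr: "g <#\<^bsub>G\<^esub> A = (\<lambda>x. g \<otimes>\<^bsub>G\<^esub> x) ` A" for g A
    by (auto simp: l_coset_def)
  have car: "(\<lambda>x. g \<otimes>\<^bsub>G\<^esub> x) ` carrier G = carrier G" if "g \<in> carrier G" for g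
    using that by (simp add: surj_const_mult)
  have inj: "inj_on (\<lambda>x. g \<otimes>\<^bsub>G\<^esub> x) (carrier G)" if "g \<in> carrier G" for g
    using that by (simp add: inj_on_cmult)
  show "{} \<in> left_commensurated G" "carrier G \<in> left_commensurated G"
    by (auto simp: left_commensurated_def tr car)
  show "carrier G - A \<in> left_commensurated G" if A: "A \<in> left_commensurated G"
  proof -
    have "finite (sym_diff (g <#\<^bsub>G\<^esub> (carrier G - A)) (carrier G - A))" if g: "g \<in> carrier G" for g
    proof -
      have "g <#\<^bsub>G\<^esub> (carrier G - A) = carrier G - (g <#\<^bsub>G\<^esub> A)"
        unfolding tr using A inj_on_image_set_diff[OF inj[OF g], of "carrier G" A] car[OF g]
        by (auto simp: left_commensurated_def)
      moreover have "sym_diff (carrier G - (g <#\<^bsub>G\<^esub> A)) (carrier G - A) \<subseteq> sym_diff (g <#\<^bsub>G\<^esub> A) A"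
        by auto
      moreover have "finite (sym_diff (g <#\<^bsub>G\<^esub> A) A)"
        using A g by (simp add: left_commensurated_def)
      ultimately show ?thesis by (metis finite_subset)
    qed
    then show ?thesis by (auto simp: left_commensurated_def)
  qed
  show un: "A \<union> B \<in> left_commensurated G"
    if A: "A \<in> left_commensurated G" and B: "B \<in> left_commensurated G" for A B
  proof -
    have "finite (sym_diff (g <#\<^bsub>G\<^esub> (A \<union> B)) (A \<union> B))" if g: "g \<in> carrier G" for g
    proof (rule finite_subset)
      show "sym_diff (g <#\<^bsub>G\<^esub> (A \<union> B)) (A \<union> B) \<subseteq> sym_diff (g <#\<^bsub>G\<^esub> A) A \<union> sym_diff (g <#\<^bsub>G\<^esub> B) B"
        by (auto simp: tr)
    qed (use A B g in \<open>auto simp: left_commensurated_def\<close>)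
    then show ?thesis using A B by (auto simp: left_commensurated_def)
  qed
  show "A \<inter> B \<in> left_commensurated G"
    if A: "A \<in> left_commensurated G" and B: "B \<in> left_commensurated G" for A B
  proof -
    have "finite (sym_diff (g <#\<^bsub>G\<^esub> (A \<inter> B)) (A \<inter> B))" if g: "g \<in> carrier G" for g
    proof (rule finite_subset)
      have "g <#\<^bsub>G\<^esub> (A \<inter> B) = (g <#\<^bsub>G\<^esub> A) \<inter> (g <#\<^bsub>G\<^esub> B)"
        unfolding tr by (rule inj_on_image_Int[OF inj[OF g]])
          (use A B in \<open>auto simp: left_commensurated_def\<close>)
      then show "sym_diff (g <#\<^bsub>G\<^esub> (A \<inter> B)) (A \<inter> B) \<subseteq> sym_diff (g <#\<^bsub>G\<^esub> A) A \<union> sym_diff (g <#\<^bsub>G\<^esub> B) B"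
        by auto
    qed (use A B g in \<open>auto simp: left_commensurated_def\<close>)
    then show ?thesis using A B by (auto simp: left_commensurated_def)
  qed
qed

lemma equiv_mod_finite: "equiv (left_commensurated G) (mod_finite G)"
proof (rule equivI)
  show "trans (mod_finite G)"
  proof (rule transI)
    fix A B C assume "(A, B) \<in> mod_finite G" "(B, C) \<in> mod_finite G"
    moreover have "sym_diff A C \<subseteq> sym_diff A B \<union> sym_diff B C" by auto
    moreover have "finite (sym_diff A B \<union> sym_diff B C)"
      using calculation(1,2) by (simp add: mod_finite_def)
    ultimately show "(A, C) \<in> mod_finite G"
      using finite_subset[of "sym_diff A C" "sym_diff A B \<union> sym_diff B C"] by (simp add: mod_finite_def)
  qed
qed (auto simp: mod_finite_def refl_on_def intro!: symI)

lemma ends_algebra_le_iff: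
  assumes "group G" and A: "A \<in> left_commensurated G" and B: "B \<in> left_commensurated G"
  shows "(mod_finite G `` {A}) \<sqsubseteq>\<^bsub>ends_algebra G\<^esub> (mod_finite G `` {B}) \<longleftrightarrow> finite (A - B)"
proof
  assume "(mod_finite G `` {A}) \<sqsubseteq>\<^bsub>ends_algebra G\<^esub> (mod_finite G `` {B})"
  then obtain A' B' where "(A, A') \<in> mod_finite G" "(B, B') \<in> mod_finite G" "A' \<subseteq> B'"
    by (auto simp: ends_algebra_def)
  moreover from this have "A - B \<subseteq> sym_diff A A' \<union> sym_diff B B'" by auto
  moreover have "finite (sym_diff A A' \<union> sym_diff B B')"
    using calculation(1,2) by (simp add: mod_finite_def)
  ultimately show "finite (A - B)" by (metis finite_subset)
next
  assume fin: "finite (A - B)"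
  have "A \<inter> B \<in> left_commensurated G"
    using left_commensurated_subalgebra(5)[OF assms] .
  moreover have "A - A \<inter> B = A - B" by auto
  moreover have "finite (A \<inter> B - A)" by (metis Diff_eq_empty_iff Int_lower1 finite.emptyI)
  ultimately have "A \<inter> B \<in> mod_finite G `` {A}" "B \<in> mod_finite G `` {B}"
    using A B fin by (auto simp: mod_finite_def)
  then show "(mod_finite G `` {A}) \<sqsubseteq>\<^bsub>ends_algebra G\<^esub> (mod_finite G `` {B})"
    unfolding ends_algebra_def gorder.simps by (metis Int_lower2)
qed


section \<open>The Stone-Cech boundary of the natural numbers\<close>

text \<open>
  The Stone-Cech compactification of the discrete space of natural numbers is the space of
  ultrafilters on it, in which a number is identified with its principal ultrafilter.
\<close>

definition nat_powerset_algebra :: "nat set gorder" where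
  "nat_powerset_algebra = \<lparr> carrier = Pow UNIV, eq = (=), le = (\<subseteq>) \<rparr>"

definition beta_nat :: "nat set set topology" where
  "beta_nat = stone_dual nat_powerset_algebra"

definition principal_ultrafilter :: "nat \<Rightarrow> nat set set" where
  "principal_ultrafilter n = {A. n \<in> A}"

definition stone_cech_boundary_nat :: "nat set set topology" where
  "stone_cech_boundary_nat =
     subtopology beta_nat (topspace beta_nat - range principal_ultrafilter)"

lemma principal_ultrafilter_in_beta_nat: "principal_ultrafilter n \<in> topspace beta_nat"
proof -
  have "F = principal_ultrafilter n"
    if F: "proper_filter nat_powerset_algebra F" and sub: "principal_ultrafilter n \<subseteq> F" for F
  proof (rule ccontr)
    assume "F \<noteq> principal_ultrafilter n"
    then obtain A where A: "A \<in> F" "n \<notin> A"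
      using sub by (auto simp: principal_ultrafilter_def)
    have "{n} \<in> F" using sub by (auto simp: principal_ultrafilter_def)
    moreover have "\<forall>X\<in>F. \<forall>Y\<in>F. \<exists>Z\<in>F. Z \<subseteq> X \<and> Z \<subseteq> Y"
      using F by (simp add: proper_filter_def order_filter_def nat_powerset_algebra_def)
    ultimately obtain Z where Z: "Z \<in> F" "Z \<subseteq> A" "Z \<subseteq> {n}"
      using A(1) by blast
    have "Z = {}" using Z(2,3) A(2) by blast
    moreover have "\<forall>X\<in>F. \<forall>Y. X \<subseteq> Y \<longrightarrow> Y \<in> F" "F \<noteq> UNIV"
      using F by (simp_all add: proper_filter_def order_filter_def nat_powerset_algebra_def)
    ultimately show False using Z(1) by blast
  qed
  moreover have "proper_filter nat_powerset_algebra (principal_ultrafilter n)"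
  proof -
    have "\<exists>Z. n \<in> Z \<and> Z \<subseteq> X \<and> Z \<subseteq> Y" if "n \<in> X" "n \<in> Y" for X Y
      using that by (intro exI[of _ "X \<inter> Y"]) simp
    moreover have "{A. n \<in> A} \<noteq> {}" "{A. n \<in> A} \<noteq> UNIV" by blast+
    ultimately show ?thesis
      unfolding proper_filter_def order_filter_def nat_powerset_algebra_def principal_ultrafilter_def
      by (simp add: subset_iff)
  qed
  ultimately show ?thesis
    unfolding beta_nat_def topspace_stone_dual is_ultrafilter_def by simp
qed


section \<open>Cellularity\<close>

definition cellular_family :: "'a topology \<Rightarrow> 'a set set \<Rightarrow> bool" where
  "cellular_family X \<F> \<longleftrightarrow>
     (\<forall>U\<in>\<F>. openin X U \<and> U \<noteq> {}) \<and> pairwise disjnt \<F>"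

definition cellularity_bound :: "'a topology \<Rightarrow> 'a set rel \<Rightarrow> bool" where
  "cellularity_bound X r \<longleftrightarrow>
     Card_order r \<and> (\<forall>\<F>. cellular_family X \<F> \<longrightarrow> |\<F>| \<le>o r)"

text \<open>
  The supremum of the cardinals of the cellular families, determined up to isomorphism of
  cardinals. It may be sought among the cardinals on the type of sets of points, since
  \<open>|UNIV|\<close> on that type is an upper bound.
\<close>

definition cellularity :: "'a topology \<Rightarrow> 'a set rel" where
  "cellularity X =
     (SOME r. cellularity_bound X r \<and> (\<forall>r'. cellularity_bound X r' \<longrightarrow> r \<le>o r'))"

definition countable_cellularity :: "'a topology \<Rightarrow> bool" where
  "countable_cellularity X \<longleftrightarrow> cellularity X \<le>o natLeq"

lemma cellularity_least_bound:
  shows "cellularity_bound X (cellularity X)"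
    and "cellularity_bound X r \<Longrightarrow> cellularity X \<le>o r"
proof -
  have "cellularity_bound X |UNIV|"
    unfolding cellularity_bound_def
    by (intro conjI allI impI card_of_Card_order card_of_mono1 subset_UNIV)
  then have "Collect (cellularity_bound X) \<noteq> {}" by blast
  moreover have "\<forall>r\<in>Collect (cellularity_bound X). Card_order r"
    by (simp add: cellularity_bound_def)
  ultimately have "\<exists>r\<in>Collect (cellularity_bound X). \<forall>r'\<in>Collect (cellularity_bound X). r \<le>o r'"
    by (rule exists_minim_Card_order)
  then have "\<exists>r. cellularity_bound X r \<and> (\<forall>r'. cellularity_bound X r' \<longrightarrow> r \<le>o r')"
    by (simp only: Bex_def Ball_def mem_Collect_eq)
  then have "cellularity_bound X (cellularity X) \<and>
      (\<forall>r'. cellularity_bound X r' \<longrightarrow> cellularity X \<le>o r')"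
    unfolding cellularity_def by (rule someI_ex)
  then show "cellularity_bound X (cellularity X)"
    and "cellularity_bound X r \<Longrightarrow> cellularity X \<le>o r"
    by blast+
qed

lemma countable_iff_card_le_natLeq: "countable A \<longleftrightarrow> |A| \<le>o natLeq"
proof -
  have "countable A \<longleftrightarrow> |A| \<le>o |UNIV :: nat set|"
    unfolding countable_def card_of_ordLeq[symmetric] by simp
  then show ?thesis
    using ordLeq_ordIso_trans[OF _ card_of_nat, of "|A|"]
      ordLeq_ordIso_trans[OF _ ordIso_symmetric[OF card_of_nat], of "|A|"]
    by blast
qed

lemma countable_cellularity_iff:
  "countable_cellularity X \<longleftrightarrow> (\<forall>\<F>. cellular_family X \<F> \<longrightarrow> countable \<F>)"
proof
  assume *: "countable_cellularity X"
  show "\<forall>\<F>. cellular_family X \<F> \<longrightarrow> countable \<F>"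
  proof (intro allI impI)
    fix \<F> assume "cellular_family X \<F>"
    then have "|\<F>| \<le>o cellularity X"
      using cellularity_least_bound(1)[of X] unfolding cellularity_bound_def by blast
    from ordLeq_transitive[OF this *[unfolded countable_cellularity_def]]
    show "countable \<F>" unfolding countable_iff_card_le_natLeq .
  qed
next
  assume *: "\<forall>\<F>. cellular_family X \<F> \<longrightarrow> countable \<F>"
  have "\<exists>C :: 'a set set. countable C \<and> (\<forall>\<F> :: 'a set set. countable \<F> \<longrightarrow> |\<F>| \<le>o |C| )"
  proof (cases "finite (UNIV :: 'a set set)")
    case True
    then show ?thesis
      by (intro exI[of _ UNIV] conjI allI impI countable_finite card_of_mono1 subset_UNIV)
  next
    case False
    then obtain C :: "'a set set" where C: "countable C" "infinite C"
      using infinite_countable_subset'[of "UNIV :: 'a set set"] by blast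
    have "natLeq \<le>o |C|"
      using C(2) infinite_iff_natLeq_ordLeq[of C] by simp
    then have "|\<F>| \<le>o |C|" if "countable \<F>" for \<F> :: "'a set set"
      using ordLeq_transitive[OF that[unfolded countable_iff_card_le_natLeq]] by blast
    with C(1) show ?thesis by blast
  qed
  then obtain C :: "'a set set"
    where C: "countable C" "\<And>\<F> :: 'a set set. countable \<F> \<Longrightarrow> |\<F>| \<le>o |C|" by blast
  have "cellularity_bound X |C|"
    unfolding cellularity_bound_def using C(2) * card_of_Card_order[of C] by blast
  from ordLeq_transitive[OF cellularity_least_bound(2)[OF this]
      C(1)[unfolded countable_iff_card_le_natLeq]]
  show "countable_cellularity X" unfolding countable_cellularity_def .
qed

end

theory Submission
  imports Defs
begin

text \<open>
  The proof runs around the circle \<open>s1\<close>, \<open>s2\<close>, \<open>s3\<close>, \<open>s4\<close>, \<open>s5\<close>, \<open>s1\<close>; only the first and the last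
  step use the group.

  If \<open>G\<close> is infinite, countable and locally finite, it is the union of an increasing sequence of
  finite subgroups, and the first stage at which an element appears is unchanged by left
  multiplication with \<open>g\<close> once that stage is past the one of \<open>g\<close>. Relabelling the stages that
  occur gives a surjection \<open>\<rho>\<close> from \<open>G\<close> to the natural numbers with finite fibres that each
  translation preserves up to finitely many points (\<open>locally_finite_level_function\<close>). Preimages
  under \<open>\<rho>\<close> are therefore commensurated, and \<open>M \<mapsto> \<rho>\<^sup>-\<^sup>1(M)\<close> embeds the subsets of \<open>\<nat>\<close> modulo the
  finite ones into the algebra of ends; the dual of this embedding is the map in \<open>s2\<close>
  (\<open>locally_finite_ends_onto_boundary\<close>).

  From \<open>s2\<close> to \<open>s3\<close>, an almost disjoint family of continuum many infinite subsets of \<open>\<nat>\<close> gives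
  pairwise disjoint nonempty open sets of the boundary, which are pulled back. From \<open>s3\<close> to \<open>s4\<close>
  is Cantor's theorem. From \<open>s4\<close> to \<open>s5\<close>, disjoint nonempty open sets contain distinct points of
  a dense set.

  From \<open>s5\<close> to \<open>s1\<close>, the space of ends is empty if \<open>G\<close> is finite. Otherwise
  suppose that \<open>G\<close> has an infinite subgroup \<open>H\<close> generated by a finite set \<open>S\<close>.
  A commensurated set \<open>A\<close> has finite boundary in the graph that joins \<open>x\<close> to \<open>s x\<close> for \<open>s \<in> S\<close>,
  whose components are the cosets \<open>H g\<close>. Two things follow. The trace of \<open>A\<close> on
  \<open>H g\<close> is determined by the boundary of \<open>A\<close> and by whether \<open>g \<in> A\<close>, so there are only countably
  many traces (\<open>countable_coset_traces\<close>). And if \<open>A\<close> is infinite then one of its traces is: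
  a finite nonempty trace is not a whole coset, so its coset meets the boundary, and this
  happens for finitely many cosets only (\<open>infinite_coset_trace\<close>). One ultrafilter for each
  infinite trace then gives a countable dense set of ends.
\<close>


section \<open>Ultrafilters of a field of sets modulo an ideal\<close>

text \<open>
  Two algebras have this form, with quotient map \<open>cls\<close>: the power set of \<open>\<nat>\<close>, where only the
  empty set is null, and the commensurated subsets of \<open>G\<close>, where the finite sets are null.
  Since \<open>null\<close> is defined on all sets, filters can also be generated by sets outside \<open>\<A>\<close>, as is needed for the traces of commensurated sets on cosets.
\<close>

locale field_of_sets_mod_ideal =
  fixes L :: "'l gorder" and \<Omega> :: "'c set" and \<A> :: "'c set set"
    and cls :: "'c set \<Rightarrow> 'l" and null :: "'c set \<Rightarrow> bool"
  assumes carrier_eq: "carrier L = cls ` \<A>"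
    and le_iff: "\<lbrakk>A \<in> \<A>; B \<in> \<A>\<rbrakk> \<Longrightarrow> cls A \<sqsubseteq>\<^bsub>L\<^esub> cls B \<longleftrightarrow> null (A - B)"
    and sub_space: "A \<in> \<A> \<Longrightarrow> A \<subseteq> \<Omega>"
    and empty_mem: "{} \<in> \<A>"
    and compl_mem: "A \<in> \<A> \<Longrightarrow> \<Omega> - A \<in> \<A>"
    and Int_mem: "\<lbrakk>A \<in> \<A>; B \<in> \<A>\<rbrakk> \<Longrightarrow> A \<inter> B \<in> \<A>"
    and null_empty: "null {}"
    and null_subset: "\<lbrakk>null A; B \<subseteq> A\<rbrakk> \<Longrightarrow> null B"
    and null_Un: "\<lbrakk>null A; null B\<rbrakk> \<Longrightarrow> null (A \<union> B)"
begin

lemma space_mem: "\<Omega> \<in> \<A>"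
  using compl_mem[OF empty_mem] by simp

lemma filter_null_superset:
  assumes "order_filter L F" "cls A \<in> F" "A \<in> \<A>" "B \<in> \<A>" "null (A - B)"
  shows "cls B \<in> F"
proof -
  have "cls A \<sqsubseteq>\<^bsub>L\<^esub> cls B" "cls B \<in> carrier L"
    using assms le_iff carrier_eq by auto
  with assms(1,2) show ?thesis unfolding order_filter_def by blast
qed

lemma filter_mem_cls:
  assumes "order_filter L F" "u \<in> F"
  obtains A where "A \<in> \<A>" "u = cls A"
proof -
  have "u \<in> cls ` \<A>" using assms carrier_eq unfolding order_filter_def by blast
  with that show thesis by blast
qed

lemma filter_space_mem:
  assumes F: "order_filter L F"
  shows "cls \<Omega> \<in> F"
proof -
  obtain u where u: "u \<in> F" using F unfolding order_filter_def by blast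
  then obtain A where A: "A \<in> \<A>" "u = cls A" using filter_mem_cls[OF F] by blast
  then have "A - \<Omega> = {}" using sub_space by blast
  with filter_null_superset[OF F, of A \<Omega>] u A space_mem null_empty show ?thesis by simp
qed

lemma filter_Int:
  assumes F: "order_filter L F" and A: "A \<in> \<A>" "cls A \<in> F" and B: "B \<in> \<A>" "cls B \<in> F"
  shows "cls (A \<inter> B) \<in> F"
proof -
  obtain z where z: "z \<in> F" "z \<sqsubseteq>\<^bsub>L\<^esub> cls A" "z \<sqsubseteq>\<^bsub>L\<^esub> cls B"
    using F A(2) B(2) unfolding order_filter_def by blast
  then obtain C where C: "C \<in> \<A>" "z = cls C"
    using F carrier_eq unfolding order_filter_def by blast
  have "null (C - A)" "null (C - B)"
    using z C A B le_iff by auto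
  then have "null (C - A \<inter> B)"
    unfolding Diff_Int by (rule null_Un)
  with filter_null_superset[OF F _ C(1) Int_mem[OF A(1) B(1)]] z C(2) show ?thesis
    by blast
qed

lemma proper_filter_iff:
  "proper_filter L F \<longleftrightarrow> order_filter L F \<and> cls {} \<notin> F"
proof -
  have "F = carrier L" if F: "order_filter L F" and "cls {} \<in> F"
  proof
    show "F \<subseteq> carrier L" using F by (simp add: order_filter_def)
    show "carrier L \<subseteq> F"
      using filter_null_superset[OF F that(2) empty_mem] null_empty carrier_eq by auto
  qed
  then show ?thesis
    using carrier_eq empty_mem by (auto simp: proper_filter_def)
qed

lemma ultrafilter_order_filter: "is_ultrafilter L U \<Longrightarrow> order_filter L U"
  by (simp add: is_ultrafilter_def proper_filter_def)

lemma ultrafilter_null: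
  assumes U: "is_ultrafilter L U" and A: "A \<in> \<A>" "null A"
  shows "cls A \<notin> U"
proof
  assume "cls A \<in> U"
  then have "cls {} \<in> U"
    using filter_null_superset[OF ultrafilter_order_filter[OF U], of A "{}"] A empty_mem by simp
  then show False
    using U by (simp add: is_ultrafilter_def proper_filter_iff)
qed

text \<open>
  Filters of the quotient are usually constructed as images of families of sets; the second
  part says that such a family can be recovered from its image.
\<close>

lemma order_filter_image:
  assumes sub: "\<F> \<subseteq> \<A>" and ne: "\<F> \<noteq> {}"
    and up: "\<And>A B. \<lbrakk>A \<in> \<F>; B \<in> \<A>; null (A - B)\<rbrakk> \<Longrightarrow> B \<in> \<F>"
    and meet: "\<And>A B. \<lbrakk>A \<in> \<F>; B \<in> \<F>\<rbrakk> \<Longrightarrow> A \<inter> B \<in> \<F>"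
  shows "order_filter L (cls ` \<F>)" and "A \<in> \<A> \<Longrightarrow> cls A \<in> cls ` \<F> \<longleftrightarrow> A \<in> \<F>"
proof -
  show "order_filter L (cls ` \<F>)"
    unfolding order_filter_def
  proof (intro conjI ballI impI)
    show "cls ` \<F> \<subseteq> carrier L" "cls ` \<F> \<noteq> {}"
      using sub ne carrier_eq by auto
    show "y \<in> cls ` \<F>" if "x \<in> cls ` \<F>" "y \<in> carrier L" "x \<sqsubseteq>\<^bsub>L\<^esub> y" for x y
    proof -
      from that carrier_eq obtain A B where AB: "A \<in> \<F>" "x = cls A" "B \<in> \<A>" "y = cls B" by auto
      then have "null (A - B)" using that(3) sub le_iff by auto
      with up AB show ?thesis by blast
    qed
    show "\<exists>z\<in>cls ` \<F>. z \<sqsubseteq>\<^bsub>L\<^esub> x \<and> z \<sqsubseteq>\<^bsub>L\<^esub> y" if xy: "x \<in> cls ` \<F>" "y \<in> cls ` \<F>" for x y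
    proof -
      from xy obtain A B where AB: "A \<in> \<F>" "x = cls A" "B \<in> \<F>" "y = cls B" by blast
      have "cls (A \<inter> B) \<sqsubseteq>\<^bsub>L\<^esub> x" "cls (A \<inter> B) \<sqsubseteq>\<^bsub>L\<^esub> y"
        using AB sub by (auto simp: subset_iff le_iff Int_mem null_empty Diff_eq_empty_iff[THEN iffD2])
      with meet AB show ?thesis by blast
    qed
  qed
  show "cls A \<in> cls ` \<F> \<longleftrightarrow> A \<in> \<F>" if A: "A \<in> \<A>"
  proof
    assume "cls A \<in> cls ` \<F>"
    then obtain B where B: "B \<in> \<F>" "cls B = cls A" by auto
    have "null (B - A)"
      using B A sub le_iff[of B A] le_iff[of A A] null_empty by auto
    with up[OF B(1) A] show "A \<in> \<F>" by simp
  qed simp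
qed

text \<open>
  Zorn's lemma applies because properness is the absence of the single element \<open>cls {}\<close>, and
  so is inherited by unions of chains.
\<close>

lemma proper_filter_extends:
  assumes "proper_filter L F"
  obtains U where "is_ultrafilter L U" "F \<subseteq> U"
proof -
  let ?P = "{H. proper_filter L H \<and> F \<subseteq> H}"
  have "\<exists>M\<in>?P. \<forall>X\<in>?P. M \<subseteq> X \<longrightarrow> X = M"
  proof (rule subset_Zorn_nonempty)
    show "?P \<noteq> {}" using assms by blast
    fix \<C> assume ne: "\<C> \<noteq> {}" and ch: "subset.chain ?P \<C>"
    have mem: "order_filter L H" "cls {} \<notin> H" "F \<subseteq> H" if "H \<in> \<C>" for H
      using ch that by (auto simp: subset_chain_def proper_filter_iff)
    have "order_filter L (\<Union>\<C>)"
      unfolding order_filter_def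
    proof (intro conjI ballI impI)
      show "\<Union>\<C> \<subseteq> carrier L" "\<Union>\<C> \<noteq> {}"
        using mem(1) ne unfolding order_filter_def by blast+
      show "y \<in> \<Union>\<C>" if "x \<in> \<Union>\<C>" "y \<in> carrier L" "x \<sqsubseteq>\<^bsub>L\<^esub> y" for x y
        using that mem(1) unfolding order_filter_def by blast
      show "\<exists>z\<in>\<Union>\<C>. z \<sqsubseteq>\<^bsub>L\<^esub> x \<and> z \<sqsubseteq>\<^bsub>L\<^esub> y" if "x \<in> \<Union>\<C>" "y \<in> \<Union>\<C>" for x y
      proof -
        from that obtain H K where HK: "H \<in> \<C>" "x \<in> H" "K \<in> \<C>" "y \<in> K" by blast
        then have "H \<subseteq> K \<or> K \<subseteq> H"
          using ch unfolding subset_chain_def by blast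
        with HK obtain J where "J \<in> \<C>" "x \<in> J" "y \<in> J" by blast
        with mem(1)[of J] show ?thesis unfolding order_filter_def by blast
      qed
    qed
    moreover have "cls {} \<notin> \<Union>\<C>" "F \<subseteq> \<Union>\<C>" using mem(2,3) ne by blast+
    ultimately show "\<Union>\<C> \<in> ?P"
      by (simp add: proper_filter_iff)
  qed
  then obtain U where U: "U \<in> ?P" "\<forall>X\<in>?P. U \<subseteq> X \<longrightarrow> X = U" ..
  have "X = U" if "proper_filter L X" "U \<subseteq> X" for X
    using U that by (metis (lifting) mem_Collect_eq subset_trans)
  with U(1) have "is_ultrafilter L U" "F \<subseteq> U"
    by (simp_all add: is_ultrafilter_def)
  then show ?thesis by (rule that)
qed

text \<open>
  The members of \<open>\<B>\<close> need not belong to \<open>\<A>\<close>: they only say which elements of \<open>\<A>\<close> are large.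
\<close>

lemma ultrafilter_of_base:
  assumes ne: "\<B> \<noteq> {}" and sub: "\<And>B. B \<in> \<B> \<Longrightarrow> B \<subseteq> \<Omega>"
    and big: "\<And>B. B \<in> \<B> \<Longrightarrow> \<not> null B"
    and dir: "\<And>B C. \<lbrakk>B \<in> \<B>; C \<in> \<B>\<rbrakk> \<Longrightarrow> \<exists>D\<in>\<B>. D \<subseteq> B \<inter> C"
  obtains U where "is_ultrafilter L U"
    "\<And>A B. \<lbrakk>A \<in> \<A>; B \<in> \<B>; null (B - A)\<rbrakk> \<Longrightarrow> cls A \<in> U"
proof -
  define \<F> where "\<F> = {A \<in> \<A>. \<exists>B\<in>\<B>. null (B - A)}"
  have ne': "\<F> \<noteq> {}"
  proof -
    obtain B where B: "B \<in> \<B>" using ne by blast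
    then have "null (B - \<Omega>)" using sub[OF B] null_empty by (simp add: Diff_eq_empty_iff[THEN iffD2])
    with B space_mem show ?thesis by (auto simp: \<F>_def)
  qed
  have up: "B \<in> \<F>" if A: "A \<in> \<F>" and B: "B \<in> \<A>" "null (A - B)" for A B
  proof -
    obtain C where C: "C \<in> \<B>" "null (C - A)" using A by (auto simp: \<F>_def)
    have "null (C - B)"
      by (rule null_subset[OF null_Un[OF C(2) B(2)]]) blast
    with C B show ?thesis by (auto simp: \<F>_def)
  qed
  have meet: "A \<inter> B \<in> \<F>" if A: "A \<in> \<F>" and B: "B \<in> \<F>" for A B
  proof -
    obtain C D where C: "C \<in> \<B>" "null (C - A)" and D: "D \<in> \<B>" "null (D - B)"
      using A B by (auto simp: \<F>_def)
    obtain K where K: "K \<in> \<B>" "K \<subseteq> C \<inter> D" using dir C D by blast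
    have "null (K - A \<inter> B)"
      by (rule null_subset[OF null_Un[OF C(2) D(2)]]) (use K in blast)
    with K A B Int_mem show ?thesis by (auto simp: \<F>_def)
  qed
  have "\<F> \<subseteq> \<A>" by (auto simp: \<F>_def)
  note filter = order_filter_image[OF this ne' up meet]
  have "{} \<notin> \<F>" using big by (auto simp: \<F>_def)
  then have "proper_filter L (cls ` \<F>)"
    using filter empty_mem by (simp add: proper_filter_iff)
  then obtain U where U: "is_ultrafilter L U" "cls ` \<F> \<subseteq> U"
    by (rule proper_filter_extends)
  from U(2) have "cls A \<in> U" if "A \<in> \<A>" "B \<in> \<B>" "null (B - A)" for A B
    using that by (auto simp: \<F>_def)
  with U(1) show ?thesis by (rule that)
qed

text \<open>
  If \<open>cls (\<Omega> - A)\<close> is not in \<open>U\<close>, then no member of \<open>U\<close> is disjoint from \<open>A\<close> modulo null sets.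
  Hence the traces on \<open>A\<close> of the members of \<open>U\<close> are the base of an ultrafilter, which contains
  \<open>U\<close> and \<open>A\<close>, and equals \<open>U\<close> by maximality.
\<close>

lemma ultrafilter_prime:
  assumes U: "is_ultrafilter L U" and A: "A \<in> \<A>"
  shows "cls A \<in> U \<or> cls (\<Omega> - A) \<in> U"
proof (rule ccontr)
  assume neither: "\<not> (cls A \<in> U \<or> cls (\<Omega> - A) \<in> U)"
  note F = ultrafilter_order_filter[OF U]
  define \<B> where "\<B> = {B \<inter> A | B. B \<in> \<A> \<and> cls B \<in> U}"
  have big: "\<not> null C" if C: "C \<in> \<B>" for C
  proof
    obtain B where B: "B \<in> \<A>" "cls B \<in> U" "C = B \<inter> A" using C by (auto simp: \<B>_def)
    assume "null C"
    then have "null (B - (\<Omega> - A))"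
      using B sub_space[OF B(1)] by (auto intro: null_subset)
    then have "cls (\<Omega> - A) \<in> U"
      using filter_null_superset[OF F B(2,1)] compl_mem[OF A] by blast
    with neither show False by blast
  qed
  have ne: "\<B> \<noteq> {}"
    using filter_space_mem[OF F] space_mem unfolding \<B>_def by blast
  have dir: "\<exists>D\<in>\<B>. D \<subseteq> B \<inter> C" if "B \<in> \<B>" "C \<in> \<B>" for B C
  proof -
    obtain B' C' where *: "B' \<in> \<A>" "cls B' \<in> U" "B = B' \<inter> A" "C' \<in> \<A>" "cls C' \<in> U" "C = C' \<inter> A"
      using \<open>B \<in> \<B>\<close> \<open>C \<in> \<B>\<close> by (auto simp: \<B>_def)
    have "B' \<inter> C' \<in> \<A>" "cls (B' \<inter> C') \<in> U"
      using filter_Int[OF F *(1,2,4,5)] Int_mem[OF *(1,4)] by simp_all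
    then have "(B' \<inter> C') \<inter> A \<in> \<B>"
      unfolding \<B>_def by blast
    moreover have "(B' \<inter> C') \<inter> A \<subseteq> B \<inter> C" using *(3,6) by blast
    ultimately show ?thesis by (rule rev_bexI)
  qed
  obtain V where V: "is_ultrafilter L V" "\<And>D B. \<lbrakk>D \<in> \<A>; B \<in> \<B>; null (B - D)\<rbrakk> \<Longrightarrow> cls D \<in> V"
    by (rule ultrafilter_of_base[OF ne _ big dir]) (auto simp: \<B>_def dest: sub_space)
  have in_V: "cls D \<in> V" if "D \<in> \<A>" "B \<in> \<A>" "cls B \<in> U" "B \<inter> A \<subseteq> D" for B D
    using V(2)[of D "B \<inter> A"] that null_empty by (auto simp: \<B>_def Diff_eq_empty_iff[THEN iffD2])
  have "U \<subseteq> V"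
  proof
    fix u assume "u \<in> U"
    moreover obtain B where "B \<in> \<A>" "u = cls B" using filter_mem_cls[OF F \<open>u \<in> U\<close>] .
    ultimately show "u \<in> V" using in_V[of B B] by simp
  qed
  moreover have "proper_filter L V" using V(1) by (simp add: is_ultrafilter_def)
  ultimately have "V = U" using U unfolding is_ultrafilter_def by metis
  moreover have "cls A \<in> V"
    using in_V[OF A space_mem filter_space_mem[OF F]] by simp
  ultimately show False using neither by blast
qed

lemma prime_filter_is_ultrafilter:
  assumes F: "proper_filter L F" and prime: "\<And>A. A \<in> \<A> \<Longrightarrow> cls A \<in> F \<or> cls (\<Omega> - A) \<in> F"
  shows "is_ultrafilter L F"
  unfolding is_ultrafilter_def
proof (intro conjI allI impI)
  show "proper_filter L F" by fact
  fix H assume H: "proper_filter L H" and sub: "F \<subseteq> H"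
  have "cls A \<in> F" if A: "A \<in> \<A>" "cls A \<in> H" for A
  proof (rule ccontr)
    assume "cls A \<notin> F"
    then have "cls (\<Omega> - A) \<in> H" using prime[OF A(1)] sub by blast
    then have "cls (A \<inter> (\<Omega> - A)) \<in> H"
      using filter_Int[of H A "\<Omega> - A"] H A compl_mem by (simp add: proper_filter_iff)
    moreover have "A \<inter> (\<Omega> - A) = {}" by blast
    ultimately show False using H by (simp add: proper_filter_iff)
  qed
  then have "H \<subseteq> F"
    using filter_mem_cls[of H] H unfolding proper_filter_def by blast
  with sub show "H = F" by blast
qed

end

lemma openin_stone_dual_basic:
  "a \<in> carrier L \<Longrightarrow> openin (stone_dual L) {U. is_ultrafilter L U \<and> a \<in> U}"
  unfolding stone_dual_def by (rule topology_generated_by_Basis) blast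

text \<open>
  The sets that generate the Stone topology form a base of it, because a filter that contains
  two elements contains a common lower bound of them.
\<close>

lemma stone_dual_basis:
  assumes "openin (stone_dual L) W" "U \<in> W"
  obtains a where "a \<in> U" "{V. is_ultrafilter L V \<and> a \<in> V} \<subseteq> W"
proof -
  have "generate_topology_on ((\<lambda>a. {U. is_ultrafilter L U \<and> a \<in> U}) ` carrier L) W"
    using assms(1) by (simp add: stone_dual_def openin_topology_generated_by_iff)
  then have "\<forall>U\<in>W. \<exists>a\<in>U. {V. is_ultrafilter L V \<and> a \<in> V} \<subseteq> W"
  proof induction
    case (Int W1 W2)
    show ?case
    proof
      fix U assume U: "U \<in> W1 \<inter> W2"
      then obtain a b where ab: "a \<in> U" "{V. is_ultrafilter L V \<and> a \<in> V} \<subseteq> W1"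
        "b \<in> U" "{V. is_ultrafilter L V \<and> b \<in> V} \<subseteq> W2" using Int.IH by blast
      have "openin (stone_dual L) W1"
        using Int.hyps(1) by (simp add: stone_dual_def openin_topology_generated_by_iff)
      then have "U \<in> topspace (stone_dual L)"
        using U openin_subset by blast
      then have filt: "order_filter L U"
        by (simp add: topspace_stone_dual is_ultrafilter_def proper_filter_def)
      then obtain c where c: "c \<in> U" "c \<sqsubseteq>\<^bsub>L\<^esub> a" "c \<sqsubseteq>\<^bsub>L\<^esub> b"
        using ab(1,3) unfolding order_filter_def by blast
      have car: "a \<in> carrier L" "b \<in> carrier L"
        using filt ab(1,3) unfolding order_filter_def by blast+
      have "V \<in> W1 \<inter> W2" if V: "is_ultrafilter L V" "c \<in> V" for V
      proof -
        have "order_filter L V"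
          using V(1) by (simp add: is_ultrafilter_def proper_filter_def)
        then have "a \<in> V" "b \<in> V"
          using V(2) c(2,3) car unfolding order_filter_def by blast+
        then show ?thesis using V(1) ab(2,4) by blast
      qed
      with c(1) show "\<exists>a\<in>U. {V. is_ultrafilter L V \<and> a \<in> V} \<subseteq> W1 \<inter> W2" by blast
    qed
  next
    case (UN K)
    then show ?case by (meson UnionE Union_upper order_trans)
  qed auto
  with assms(2) that show ?thesis by blast
qed


section \<open>The two Boolean algebras\<close>

interpretation nat_sets: field_of_sets_mod_ideal
  nat_powerset_algebra UNIV UNIV "\<lambda>A. A" "\<lambda>A. A = {}"
  by unfold_locales (auto simp: nat_powerset_algebra_def)

text \<open>
  An ultrafilter with a finite member contains a singleton by primeness, and an ultrafilter
  that contains a singleton is principal.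
\<close>

lemma topspace_stone_cech_boundary_nat:
  "topspace stone_cech_boundary_nat =
     {V. is_ultrafilter nat_powerset_algebra V \<and> (\<forall>M\<in>V. infinite M)}"
proof -
  have "\<forall>M\<in>V. infinite M"
    if V: "is_ultrafilter nat_powerset_algebra V" and np: "V \<notin> range principal_ultrafilter" for V
  proof -
    note F = nat_sets.ultrafilter_order_filter[OF V]
    have single: "{n} \<notin> V" for n
    proof
      assume n: "{n} \<in> V"
      have "principal_ultrafilter n \<subseteq> V"
        using nat_sets.filter_null_superset[OF F n] by (auto simp: principal_ultrafilter_def)
      moreover have "is_ultrafilter nat_powerset_algebra (principal_ultrafilter n)"
        using principal_ultrafilter_in_beta_nat by (simp add: beta_nat_def topspace_stone_dual)
      ultimately have "V = principal_ultrafilter n"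
        using V unfolding is_ultrafilter_def by metis
      with np show False by blast
    qed
    have "M \<notin> V" if "finite M" for M
      using that
    proof induction
      case empty
      show ?case using nat_sets.ultrafilter_null[OF V] by blast
    next
      case (insert n M)
      show ?case
      proof
        assume *: "insert n M \<in> V"
        have "- {n} \<in> V"
          using nat_sets.ultrafilter_prime[OF V, of "{n}"] single by (simp add: Compl_eq_Diff_UNIV)
        then have "insert n M \<inter> - {n} \<in> V"
          using nat_sets.filter_Int[OF F _ *] by blast
        moreover have "insert n M \<inter> - {n} = M" using insert.hyps by auto
        ultimately show False using insert.IH by simp
      qed
    qed
    then show ?thesis by blast
  qed
  moreover have "V \<notin> range principal_ultrafilter" if "\<forall>M\<in>V. infinite M" for V
    using that by (force simp: principal_ultrafilter_def)
  ultimately show ?thesis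
    unfolding stone_cech_boundary_nat_def by (auto simp: beta_nat_def topspace_stone_dual)
qed

lemma ends_algebra_field_of_sets:
  assumes "group G"
  shows "field_of_sets_mod_ideal (ends_algebra G) (carrier G) (left_commensurated G)
           (\<lambda>A. mod_finite G `` {A}) finite"
proof
  show "carrier (ends_algebra G) = (\<lambda>A. mod_finite G `` {A}) ` left_commensurated G"
    by (auto simp: ends_algebra_def quotient_def)
  show "A \<subseteq> carrier G" if "A \<in> left_commensurated G" for A
    using that by (simp add: left_commensurated_def)
  show "\<And>A B. \<lbrakk>A \<in> left_commensurated G; B \<in> left_commensurated G\<rbrakk> \<Longrightarrow>
      (mod_finite G `` {A} \<sqsubseteq>\<^bsub>ends_algebra G\<^esub> mod_finite G `` {B}) = finite (A - B)"
    by (rule ends_algebra_le_iff[OF assms])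
  show "{} \<in> left_commensurated G"
    and "\<And>A. A \<in> left_commensurated G \<Longrightarrow> carrier G - A \<in> left_commensurated G"
    and "\<And>A B. \<lbrakk>A \<in> left_commensurated G; B \<in> left_commensurated G\<rbrakk>
           \<Longrightarrow> A \<inter> B \<in> left_commensurated G"
    by (fact left_commensurated_subalgebra[OF assms])+
qed (auto intro: finite_subset)


section \<open>Locally finite groups\<close>

lemma countable_locally_finite_exhaustion:
  assumes lf: "locally_finite_group G" and cnt: "countable (carrier G)"
  obtains F :: "nat \<Rightarrow> 'a set"
  where "\<And>n. subgroup (F n) G" "\<And>n. finite (F n)" "mono F" "(\<Union>n. F n) = carrier (G :: ('a, 'b) monoid_scheme)"
proof -
  interpret group G using lf by (simp add: locally_finite_group_def)
  define S where "S n = from_nat_into (carrier G) ` {..<n}" for n :: nat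
  have ne: "carrier G \<noteq> {}" by blast
  have S: "S n \<subseteq> carrier G" for n
    using from_nat_into[OF ne] by (auto simp: S_def)
  show ?thesis
  proof
    show "subgroup (generate G (S n)) G" for n
      by (rule generate_is_subgroup[OF S])
    show "finite (generate G (S n))" for n
      using lf S[of n] by (simp add: locally_finite_group_def S_def)
    show "mono (\<lambda>n. generate G (S n))"
      by (intro monoI mono_generate) (auto simp: S_def)
    show "(\<Union>n. generate G (S n)) = carrier G"
    proof
      show "(\<Union>n. generate G (S n)) \<subseteq> carrier G"
        using generate_incl[OF S] by blast
      show "carrier G \<subseteq> (\<Union>n. generate G (S n))"
      proof
        fix x assume "x \<in> carrier G"
        then obtain n where "from_nat_into (carrier G) n = x"
          using from_nat_into_surj[OF cnt] by blast
        then have "x \<in> S (Suc n)" by (auto simp: S_def)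
        then have "x \<in> generate G (S (Suc n))" by (rule generate.incl)
        then show "x \<in> (\<Union>n. generate G (S n))" by blast
      qed
    qed
  qed
qed

text \<open>
  The stage \<open>l x\<close> of \<open>x\<close> is the least \<open>n\<close> with \<open>x \<in> F n\<close>. For \<open>n \<ge> l g\<close> the subgroup \<open>F n\<close> contains
  \<open>g\<close> and is preserved by translation with it, so only the points of the finite set \<open>F (l g)\<close> can
  change their stage.
\<close>

lemma locally_finite_level_function:
  fixes G :: "('a, 'b) monoid_scheme"
  assumes lf: "locally_finite_group G" and cnt: "countable (carrier G)" and inf: "infinite (carrier G)"
  obtains \<rho> :: "'a \<Rightarrow> nat"
  where "\<rho> ` carrier G = UNIV" "\<And>n. finite {x \<in> carrier G. \<rho> x = n}"
    "\<And>g. g \<in> carrier G \<Longrightarrow> finite {x \<in> carrier G. \<rho> (g \<otimes>\<^bsub>G\<^esub> x) \<noteq> \<rho> x}"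
proof -
  interpret group G using lf by (simp add: locally_finite_group_def)
  obtain F :: "nat \<Rightarrow> 'a set" where F: "\<And>n. subgroup (F n) G" "\<And>n. finite (F n)" "mono F"
    "(\<Union>n. F n) = carrier G"
    using countable_locally_finite_exhaustion[OF lf cnt] by blast
  define l where "l x = (LEAST n. x \<in> F n)" for x
  have l_le: "l x \<le> n \<longleftrightarrow> x \<in> F n" if x: "x \<in> carrier G" for x n
  proof
    obtain k where "x \<in> F k" using F(4) x by blast
    then have "x \<in> F (l x)" unfolding l_def by (rule LeastI)
    then show "l x \<le> n \<Longrightarrow> x \<in> F n" using monoD[OF F(3)] by blast
  qed (auto simp: l_def intro: Least_le)
  have fib: "finite {x \<in> carrier G. l x = n}" for n
    by (rule finite_subset[OF _ F(2)[of n]]) (use l_le in auto)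
  have invar: "finite {x \<in> carrier G. l (g \<otimes>\<^bsub>G\<^esub> x) \<noteq> l x}" if g: "g \<in> carrier G" for g
  proof (rule finite_subset[OF _ F(2)])
    have mult: "g \<otimes>\<^bsub>G\<^esub> x \<in> F n \<longleftrightarrow> x \<in> F n" if x: "x \<in> carrier G" and n: "l g \<le> n" for x n
    proof -
      interpret Fn: subgroup "F n" G by (rule F(1))
      have gF: "g \<in> F n" using l_le[OF g] n by simp
      have "x = inv\<^bsub>G\<^esub> g \<otimes>\<^bsub>G\<^esub> (g \<otimes>\<^bsub>G\<^esub> x)"
        using g x by (simp add: m_assoc[symmetric])
      then show ?thesis using gF Fn.m_closed Fn.m_inv_closed by metis
    qed
    show "{x \<in> carrier G. l (g \<otimes>\<^bsub>G\<^esub> x) \<noteq> l x} \<subseteq> F (l g)"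
    proof (rule subsetI, rule ccontr)
      fix x assume "x \<in> {x \<in> carrier G. l (g \<otimes>\<^bsub>G\<^esub> x) \<noteq> l x}" and out: "x \<notin> F (l g)"
      then have x: "x \<in> carrier G" "l (g \<otimes>\<^bsub>G\<^esub> x) \<noteq> l x" by auto
      have gx: "g \<otimes>\<^bsub>G\<^esub> x \<in> carrier G" using g x by simp
      have "l (g \<otimes>\<^bsub>G\<^esub> x) \<le> n \<longleftrightarrow> l x \<le> n" if "l g \<le> n" for n
        using mult[OF x(1) that] l_le gx x(1) by simp
      moreover have "\<not> l x \<le> l g" using out l_le[OF x(1)] by simp
      ultimately show False using x(2) by (meson le_antisym le_refl nle_le)
    qed
  qed
  \<comment> \<open>Successive subgroups may coincide, so some stages may be empty. Renumbering the
      infinitely many nonempty ones makes the function surjective, so that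
      infinite sets have infinite preimages.\<close>
  have "infinite (l ` carrier G)"
  proof
    assume "finite (l ` carrier G)"
    moreover have "carrier G = (\<Union>n\<in>l ` carrier G. {x \<in> carrier G. l x = n})" by blast
    ultimately have "finite (carrier G)" using fib by (metis (no_types, lifting) finite_UN_I)
    with inf show False by blast
  qed
  then have bij: "bij_betw (to_nat_on (l ` carrier G)) (l ` carrier G) UNIV"
    by (intro to_nat_on_infinite) auto
  show ?thesis
  proof
    let ?\<rho> = "\<lambda>x. to_nat_on (l ` carrier G) (l x)"
    show "?\<rho> ` carrier G = UNIV"
      using bij_betw_imp_surj_on[OF bij] by (simp add: image_image)
    have inj: "?\<rho> x = ?\<rho> y \<longleftrightarrow> l x = l y" if "x \<in> carrier G" "y \<in> carrier G" for x y
      using bij_betw_imp_inj_on[OF bij] that by (simp add: inj_on_eq_iff)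
    show "finite {x \<in> carrier G. ?\<rho> x = n}" for n
    proof (cases "\<exists>y\<in>carrier G. ?\<rho> y = n")
      case True
      then obtain y where y: "y \<in> carrier G" "?\<rho> y = n" by blast
      have "{x \<in> carrier G. ?\<rho> x = n} \<subseteq> {x \<in> carrier G. l x = l y}"
      proof (intro subsetI CollectI, elim CollectE conjE)
        fix x assume "x \<in> carrier G" "?\<rho> x = n"
        with inj[OF _ y(1), of x] y(2) show "x \<in> carrier G \<and> l x = l y" by simp
      qed
      then show ?thesis using fib by (rule finite_subset)
    next
      case False
      then have "{x \<in> carrier G. ?\<rho> x = n} = {}" by blast
      then show ?thesis by (simp only: finite.emptyI)
    qed
    show "finite {x \<in> carrier G. ?\<rho> (g \<otimes>\<^bsub>G\<^esub> x) \<noteq> ?\<rho> x}" if g: "g \<in> carrier G" for g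
    proof (rule finite_subset[OF _ invar[OF g]])
      show "{x \<in> carrier G. ?\<rho> (g \<otimes>\<^bsub>G\<^esub> x) \<noteq> ?\<rho> x} \<subseteq> {x \<in> carrier G. l (g \<otimes>\<^bsub>G\<^esub> x) \<noteq> l x}"
        by auto
    qed
  qed
qed

lemma level_preimage_commensurated:
  assumes "group G"
    and \<rho>: "\<And>g. g \<in> carrier G \<Longrightarrow> finite {x \<in> carrier G. \<rho> (g \<otimes>\<^bsub>G\<^esub> x) \<noteq> \<rho> x}"
  shows "{x \<in> carrier G. \<rho> x \<in> M} \<in> left_commensurated G"
  unfolding left_commensurated_def
proof (intro CollectI conjI ballI)
  interpret group G by fact
  fix g assume g: "g \<in> carrier G"
  let ?A = "{x \<in> carrier G. \<rho> x \<in> M}" and ?E = "\<lambda>g. {x \<in> carrier G. \<rho> (g \<otimes>\<^bsub>G\<^esub> x) \<noteq> \<rho> x}"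
  have "sym_diff (g <#\<^bsub>G\<^esub> ?A) ?A \<subseteq> (\<lambda>x. g \<otimes>\<^bsub>G\<^esub> x) ` ?E g \<union> ?E (inv\<^bsub>G\<^esub> g)"
  proof
    fix y assume "y \<in> sym_diff (g <#\<^bsub>G\<^esub> ?A) ?A"
    then consider "y \<in> g <#\<^bsub>G\<^esub> ?A" "y \<notin> ?A" | "y \<notin> g <#\<^bsub>G\<^esub> ?A" "y \<in> ?A" by blast
    then show "y \<in> (\<lambda>x. g \<otimes>\<^bsub>G\<^esub> x) ` ?E g \<union> ?E (inv\<^bsub>G\<^esub> g)"
    proof cases
      case 1
      then obtain x where "x \<in> ?A" "y = g \<otimes>\<^bsub>G\<^esub> x" by (auto simp: l_coset_def)
      moreover from this have "\<rho> (g \<otimes>\<^bsub>G\<^esub> x) \<noteq> \<rho> x" using 1(2) g by auto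
      ultimately show ?thesis by blast
    next
      case 2
      have y: "y = g \<otimes>\<^bsub>G\<^esub> (inv\<^bsub>G\<^esub> g \<otimes>\<^bsub>G\<^esub> y)"
        using g 2(2) by (simp add: m_assoc[symmetric])
      have "inv\<^bsub>G\<^esub> g \<otimes>\<^bsub>G\<^esub> y \<notin> ?A"
        using 2(1) y unfolding l_coset_def by blast
      then have "\<rho> (inv\<^bsub>G\<^esub> g \<otimes>\<^bsub>G\<^esub> y) \<noteq> \<rho> y" using g 2(2) by auto
      then show ?thesis using 2(2) by blast
    qed
  qed
  then show "finite (sym_diff (g <#\<^bsub>G\<^esub> ?A) ?A)"
    using \<rho>[OF g] \<rho>[OF inv_closed[OF g]] by (meson finite_Un finite_imageI finite_subset)
qed blast

text \<open>
  The map is \<open>f U = {M. \<rho>\<^sup>-\<^sup>1(M) \<in> U}\<close>, the Stone dual of the homomorphism \<open>M \<mapsto> \<rho>\<^sup>-\<^sup>1(M)\<close>. It avoids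
  the principal ultrafilters because the fibres of \<open>\<rho>\<close> are finite. It is onto because the
  preimages of the members of a nonprincipal ultrafilter are infinite and directed, and an
  ultrafilter that contains all of them is mapped to a filter above the given one.
\<close>

proposition locally_finite_ends_onto_boundary:
  fixes G :: "('a, 'b) monoid_scheme"
  assumes lf: "locally_finite_group G" and cnt: "countable (carrier G)" and inf: "infinite (carrier G)"
  shows "\<exists>f. continuous_map (space_of_ends G) stone_cech_boundary_nat f \<and>
             f ` topspace (space_of_ends G) = topspace stone_cech_boundary_nat"
proof -
  have grp: "group G" using lf by (simp add: locally_finite_group_def)
  interpret E: field_of_sets_mod_ideal "ends_algebra G" "carrier G" "left_commensurated G"
    "\<lambda>A. mod_finite G `` {A}" finite
    by (rule ends_algebra_field_of_sets[OF grp])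
  obtain \<rho> :: "'a \<Rightarrow> nat" where surj: "\<rho> ` carrier G = UNIV"
    and fib: "\<And>n. finite {x \<in> carrier G. \<rho> x = n}"
    and invar: "\<And>g. g \<in> carrier G \<Longrightarrow> finite {x \<in> carrier G. \<rho> (g \<otimes>\<^bsub>G\<^esub> x) \<noteq> \<rho> x}"
    using locally_finite_level_function[OF lf cnt inf] by blast
  define pre where "pre M = {x \<in> carrier G. \<rho> x \<in> M}" for M
  have pre_mem: "pre M \<in> left_commensurated G" for M
    unfolding pre_def by (rule level_preimage_commensurated[OF grp invar])
  have pre_finite: "finite (pre M) \<longleftrightarrow> finite M" for M
  proof
    have "M = \<rho> ` pre M" using surj by (auto simp: pre_def)
    then show "finite (pre M) \<Longrightarrow> finite M" by (metis finite_imageI)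
    have "pre M = (\<Union>n\<in>M. {x \<in> carrier G. \<rho> x = n})" by (auto simp: pre_def)
    then show "finite M \<Longrightarrow> finite (pre M)" using fib by simp
  qed
  have pre_Int: "pre (M \<inter> N) = pre M \<inter> pre N" and pre_compl: "pre (UNIV - M) = carrier G - pre M" for M N
    by (auto simp: pre_def)
  define f where "f U = {M. mod_finite G `` {pre M} \<in> U}" for U
  have f_mem: "f U \<in> topspace stone_cech_boundary_nat" if U: "is_ultrafilter (ends_algebra G) U" for U
  proof -
    note F = E.ultrafilter_order_filter[OF U]
    have inf': "infinite M" if "M \<in> f U" for M
      using that E.ultrafilter_null[OF U pre_mem, of M] pre_finite by (auto simp: f_def)
    have prime: "M \<in> f U \<or> UNIV - M \<in> f U" for M
      using E.ultrafilter_prime[OF U pre_mem, of M] by (simp add: f_def pre_compl)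
    have up: "N \<in> f U" if "M \<in> f U" "M \<subseteq> N" for M N
    proof -
      have "pre M - pre N = {}" using that(2) by (auto simp: pre_def)
      then have "finite (pre M - pre N)" by (simp only: finite.emptyI)
      then show ?thesis
        using that(1) E.filter_null_superset[OF F _ pre_mem pre_mem] unfolding f_def by simp
    qed
    have meet: "M \<inter> N \<in> f U" if "M \<in> f U" "N \<in> f U" for M N
      using that E.filter_Int[OF F pre_mem _ pre_mem] by (simp add: f_def pre_Int)
    have "f U \<noteq> {}" using prime by blast
    then have "order_filter nat_powerset_algebra (f U)"
      using nat_sets.order_filter_image(1)[of "f U"] up meet by simp
    moreover have "{} \<notin> f U" using inf' by blast
    ultimately have "proper_filter nat_powerset_algebra (f U)"
      by (simp add: nat_sets.proper_filter_iff)
    with prime have "is_ultrafilter nat_powerset_algebra (f U)"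
      by (intro nat_sets.prime_filter_is_ultrafilter) auto
    with inf' show ?thesis by (simp add: topspace_stone_cech_boundary_nat)
  qed
  have top: "topspace (space_of_ends G) = {U. is_ultrafilter (ends_algebra G) U}"
    by (simp add: space_of_ends_def topspace_stone_dual)
  have "continuous_map (space_of_ends G) beta_nat f"
    unfolding beta_nat_def stone_dual_def
  proof (subst continuous_on_generated_topo_iff, intro conjI allI impI)
    fix W assume "W \<in> (\<lambda>a. {U. is_ultrafilter nat_powerset_algebra U \<and> a \<in> U}) ` carrier nat_powerset_algebra"
    then obtain M where W: "W = {V. is_ultrafilter nat_powerset_algebra V \<and> M \<in> V}" by blast
    have "f -` W \<inter> topspace (space_of_ends G) =
        {U. is_ultrafilter (ends_algebra G) U \<and> mod_finite G `` {pre M} \<in> U}"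
      using f_mem by (auto simp: W top topspace_stone_cech_boundary_nat f_def)
    moreover have "mod_finite G `` {pre M} \<in> carrier (ends_algebra G)"
      using E.carrier_eq pre_mem by blast
    ultimately show "openin (space_of_ends G) (f -` W \<inter> topspace (space_of_ends G))"
      using openin_stone_dual_basic by (simp add: space_of_ends_def)
  next
    have "f ` topspace (space_of_ends G) \<subseteq> topspace beta_nat"
      using f_mem by (auto simp: top topspace_stone_cech_boundary_nat beta_nat_def topspace_stone_dual)
    then show "f ` topspace (space_of_ends G)
        \<subseteq> \<Union> ((\<lambda>a. {U. is_ultrafilter nat_powerset_algebra U \<and> a \<in> U}) ` carrier nat_powerset_algebra)"
      by (simp only: beta_nat_def stone_dual_def topology_generated_by_topspace)
  qed
  moreover have onto: "topspace stone_cech_boundary_nat \<subseteq> f ` topspace (space_of_ends G)"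
  proof
    fix V assume "V \<in> topspace stone_cech_boundary_nat"
    then have V: "is_ultrafilter nat_powerset_algebra V" "\<And>M. M \<in> V \<Longrightarrow> infinite M"
      by (auto simp: topspace_stone_cech_boundary_nat)
    note F = nat_sets.ultrafilter_order_filter[OF V(1)]
    have ne: "pre ` V \<noteq> {}" using F by (simp add: order_filter_def)
    have dir: "\<exists>D\<in>pre ` V. D \<subseteq> B \<inter> C" if BC: "B \<in> pre ` V" "C \<in> pre ` V" for B C
    proof -
      obtain M N where MN: "M \<in> V" "B = pre M" "N \<in> V" "C = pre N"
        using BC by blast
      have "M \<inter> N \<in> V" using nat_sets.filter_Int[OF F UNIV_I MN(1) UNIV_I MN(3)] .
      then show ?thesis using pre_Int MN(2,4) by (metis imageI order_refl)
    qed
    obtain U where U: "is_ultrafilter (ends_algebra G) U"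
      "\<And>A B. \<lbrakk>A \<in> left_commensurated G; B \<in> pre ` V; finite (B - A)\<rbrakk> \<Longrightarrow> mod_finite G `` {A} \<in> U"
      by (rule E.ultrafilter_of_base[OF ne _ _ dir])
         (auto simp: pre_finite V(2), auto simp: pre_def)
    have "V \<subseteq> f U"
    proof
      fix M assume "M \<in> V"
      then have "mod_finite G `` {pre M} \<in> U"
        using U(2)[OF pre_mem, of "pre M" M] by simp
      then show "M \<in> f U" by (simp add: f_def)
    qed
    moreover have "proper_filter nat_powerset_algebra (f U)"
      using f_mem[OF U(1)] by (simp add: topspace_stone_cech_boundary_nat is_ultrafilter_def)
    ultimately have "f U = V" using V(1) unfolding is_ultrafilter_def by metis
    with U(1) show "V \<in> f ` topspace (space_of_ends G)" by (auto simp: top)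
  qed
  moreover have "f ` topspace (space_of_ends G) \<subseteq> topspace stone_cech_boundary_nat"
    using f_mem by (auto simp: top)
  ultimately show ?thesis
    unfolding stone_cech_boundary_nat_def
    by (intro exI[of _ f]) (auto simp: continuous_map_in_subtopology)
qed


section \<open>Cellularity\<close>

text \<open>
  The set \<open>M x\<close> consists of codes for the initial segments of \<open>x\<close>, as in the branches of the
  binary tree: two distinct sets share initial segments only up to the first place where they
  differ. The length of the segment is part of the code, so that \<open>M x\<close> is infinite even when
  \<open>x\<close> is finite.
\<close>

lemma almost_disjoint_family:
  obtains M :: "nat set \<Rightarrow> nat set"
  where "\<And>x. infinite (M x)" "\<And>x y. x \<noteq> y \<Longrightarrow> finite (M x \<inter> M y)"
proof
  let ?c = "\<lambda>x n. prod_encode (n, set_encode (x \<inter> {..<n}))"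
  let ?M = "\<lambda>x. range (?c x)"
  show "infinite (?M x)" for x
    by (rule range_inj_infinite) (auto intro: injI)
  show "finite (?M x \<inter> ?M y)" if "x \<noteq> y" for x y
  proof -
    obtain k where k: "k \<in> x \<longleftrightarrow> k \<notin> y" using \<open>x \<noteq> y\<close> by blast
    have "?M x \<inter> ?M y \<subseteq> ?c x ` {..k}"
    proof
      fix z assume "z \<in> ?M x \<inter> ?M y"
      then obtain n where z: "z = ?c x n" and "set_encode (x \<inter> {..<n}) = set_encode (y \<inter> {..<n})"
        by auto
      then have "x \<inter> {..<n} = y \<inter> {..<n}"
        by (simp add: set_encode_eq)
      with k have "n \<le> k" by (metis IntD1 IntI lessThan_iff not_le)
      with z show "z \<in> ?c x ` {..k}" by blast
    qed
    then show ?thesis using finite_surj by blast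
  qed
qed

lemma onto_boundary_imp_continuum_cellular_family:
  assumes f: "continuous_map X stone_cech_boundary_nat f"
    and onto: "f ` topspace X = topspace stone_cech_boundary_nat"
  shows "\<exists>\<F>. cellular_family X \<F> \<and> |\<F>| =o ctwo ^c natLeq"
proof -
  obtain M :: "nat set \<Rightarrow> nat set"
    where inf: "\<And>x. infinite (M x)" and ad: "\<And>x y. x \<noteq> y \<Longrightarrow> finite (M x \<inter> M y)"
    using almost_disjoint_family by blast
  define W where "W x = {p \<in> topspace X. M x \<in> f p}" for x
  have bd: "is_ultrafilter nat_powerset_algebra (f p)" "\<And>K. K \<in> f p \<Longrightarrow> infinite K"
    if "p \<in> topspace X" for p
    using that onto by (auto simp: topspace_stone_cech_boundary_nat)
  have opn: "openin X (W x)" for x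
  proof -
    let ?B = "{V. is_ultrafilter nat_powerset_algebra V \<and> M x \<in> V}"
    have "openin beta_nat ?B"
      unfolding beta_nat_def by (rule openin_stone_dual_basic) (simp add: nat_powerset_algebra_def)
    moreover have "continuous_map X beta_nat f"
      using f by (simp add: stone_cech_boundary_nat_def continuous_map_in_subtopology)
    ultimately have "openin X {p \<in> topspace X. f p \<in> ?B}"
      by (rule openin_continuous_map_preimage[rotated])
    moreover have "{p \<in> topspace X. f p \<in> ?B} = W x"
      using bd by (auto simp: W_def)
    ultimately show ?thesis by simp
  qed
  have ne: "W x \<noteq> {}" for x
  proof -
    \<comment> \<open>Removing the finite sets from \<open>M x\<close> forces an ultrafilter on it to be nonprincipal.\<close>
    define \<B> where "\<B> = {M x - K | K. finite K}"
    have ne: "\<B> \<noteq> {}" by (auto simp: \<B>_def)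
    have big: "C \<noteq> {}" if "C \<in> \<B>" for C
      using that inf[of x] by (auto simp: \<B>_def dest: finite_subset)
    have dir: "\<exists>D\<in>\<B>. D \<subseteq> B \<inter> C" if BC: "B \<in> \<B>" "C \<in> \<B>" for B C
    proof -
      from BC obtain K K' where "finite K" "finite K'" "B = M x - K" "C = M x - K'"
        unfolding \<B>_def by blast
      then show ?thesis
        by (intro bexI[of _ "M x - (K \<union> K')"]) (auto simp: \<B>_def)
    qed
    obtain V where V: "is_ultrafilter nat_powerset_algebra V"
      "\<And>A B. \<lbrakk>A \<in> UNIV; B \<in> \<B>; B - A = {}\<rbrakk> \<Longrightarrow> A \<in> V"
      by (rule nat_sets.ultrafilter_of_base[of \<B>]) (use ne big dir in auto)
    have inV: "M x - K \<in> V" if K: "finite K" for K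
    proof -
      have "M x - K \<in> \<B>" using K by (auto simp: \<B>_def)
      then show ?thesis using V(2)[of "M x - K" "M x - K"] by simp
    qed
    have "infinite K" if K: "K \<in> V" for K
    proof
      assume "finite K"
      then have "K \<inter> (M x - K) \<in> V"
        using nat_sets.filter_Int[OF nat_sets.ultrafilter_order_filter[OF V(1)] _ K] inV by blast
      moreover have "K \<inter> (M x - K) = {}" by blast
      ultimately show False using nat_sets.ultrafilter_null[OF V(1), of "{}"] by simp
    qed
    then have "V \<in> f ` topspace X"
      using V(1) onto by (simp add: topspace_stone_cech_boundary_nat)
    moreover have "M x \<in> V" using inV[of "{}"] by simp
    ultimately show ?thesis by (auto simp: W_def)
  qed
  have disj: "disjnt (W x) (W y)" if "x \<noteq> y" for x y
    unfolding disjnt_iff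
  proof (intro allI notI)
    fix p assume "p \<in> W x \<and> p \<in> W y"
    then have p: "p \<in> topspace X" "M x \<in> f p" "M y \<in> f p" by (auto simp: W_def)
    have "M x \<inter> M y \<in> f p"
      using nat_sets.filter_Int[OF nat_sets.ultrafilter_order_filter[OF bd(1)[OF p(1)]] _ p(2) _ p(3)]
      by blast
    with bd(2)[OF p(1)] ad[OF that] show False by blast
  qed
  have "inj W"
    using disj ne by (metis disjnt_self_iff_empty injI)
  then have "|range W| =o |Pow (UNIV :: nat set)|"
    using ordIso_symmetric[OF card_of_ordIsoI[OF inj_on_imp_bij_betw]] by simp
  moreover have "|Pow (UNIV :: nat set)| =o ctwo ^c natLeq"
    using card_of_Pow_Func[of "UNIV :: nat set"] by (simp add: cexp_def ctwo_def Field_natLeq Field_card_of)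
  ultimately have "|range W| =o ctwo ^c natLeq" by (rule ordIso_transitive)
  moreover have "pairwise disjnt (range W)"
    by (rule pairwise_imageI) (rule disj)
  then have "cellular_family X (range W)"
    using opn ne by (auto simp: cellular_family_def)
  ultimately show ?thesis by blast
qed

lemma continuum_cellular_family_imp_not_countable_cellularity:
  assumes "cellular_family X \<F>" "|\<F>| =o ctwo ^c natLeq"
  shows "\<not> countable_cellularity X"
proof
  assume "countable_cellularity X"
  with assms(1) have "|\<F>| \<le>o natLeq"
    by (simp add: countable_cellularity_iff countable_iff_card_le_natLeq)
  moreover have "natLeq <o ctwo ^c natLeq"
    by (rule ordLess_ctwo_cexp[OF natLeq_Card_order])
  ultimately show False
    using assms(2) by (meson not_ordLess_ordLeq ordIso_symmetric ordIso_ordLeq_trans)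
qed

lemma separable_imp_countable_cellularity:
  assumes "separable_space X"
  shows "countable_cellularity X"
  unfolding countable_cellularity_iff
proof (intro allI impI)
  fix \<F> assume \<F>: "cellular_family X \<F>"
  obtain C where C: "countable C" "X closure_of C = topspace X"
    using assms unfolding separable_space_def by blast
  have "\<exists>c. c \<in> C \<inter> U" if "U \<in> \<F>" for U
    using C(2) \<F> that dense_intersects_open[of X C] unfolding cellular_family_def by blast
  then obtain c where c: "\<And>U. U \<in> \<F> \<Longrightarrow> c U \<in> C \<inter> U" by metis
  have "inj_on c \<F>"
  proof (rule inj_onI, rule ccontr)
    fix U V assume UV: "U \<in> \<F>" "V \<in> \<F>" "c U = c V" "U \<noteq> V"
    then have "disjnt U V" using \<F> by (simp add: cellular_family_def pairwise_def)
    with UV(3) c[OF UV(1)] c[OF UV(2)] show False by (auto simp: disjnt_iff)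
  qed
  moreover have "countable (c ` \<F>)"
    using C(1) c by (auto intro: countable_subset)
  ultimately show "countable \<F>" by (rule countable_image_inj_on[rotated])
qed


section \<open>Groups that are not locally finite\<close>

text \<open>
  A base of the nonempty open sets of the space of ends is given by the infinite commensurated
  sets \<open>A\<close>. Choosing for each \<open>B \<in> \<B>\<close> an end that lies in every commensurated set above \<open>B\<close>
  yields a point of each of them.
\<close>

lemma space_of_ends_separable_if_countable_pi_base:
  assumes grp: "group G" and cnt: "countable \<B>"
    and sub: "\<And>B. B \<in> \<B> \<Longrightarrow> B \<subseteq> carrier G \<and> infinite B"
    and below: "\<And>A. \<lbrakk>A \<in> left_commensurated G; infinite A\<rbrakk> \<Longrightarrow> \<exists>B\<in>\<B>. B \<subseteq> A"
  shows "separable_space (space_of_ends G)"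
proof -
  interpret E: field_of_sets_mod_ideal "ends_algebra G" "carrier G" "left_commensurated G"
    "\<lambda>A. mod_finite G `` {A}" finite
    by (rule ends_algebra_field_of_sets[OF grp])
  have "\<exists>U. is_ultrafilter (ends_algebra G) U \<and>
      (\<forall>A\<in>left_commensurated G. B \<subseteq> A \<longrightarrow> mod_finite G `` {A} \<in> U)" if B: "B \<in> \<B>" for B
  proof -
    obtain U where "is_ultrafilter (ends_algebra G) U"
      "\<And>A B'. \<lbrakk>A \<in> left_commensurated G; B' \<in> {B}; finite (B' - A)\<rbrakk> \<Longrightarrow> mod_finite G `` {A} \<in> U"
      by (rule E.ultrafilter_of_base[of "{B}"]) (use sub[OF B] in auto)
    then show ?thesis by (metis Diff_eq_empty_iff finite.emptyI singletonI)
  qed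
  then obtain u where u: "\<And>B. B \<in> \<B> \<Longrightarrow> is_ultrafilter (ends_algebra G) (u B)"
    "\<And>A B. \<lbrakk>B \<in> \<B>; A \<in> left_commensurated G; B \<subseteq> A\<rbrakk> \<Longrightarrow> mod_finite G `` {A} \<in> u B"
    by metis
  have "u ` \<B> \<inter> W \<noteq> {}" if W: "openin (space_of_ends G) W" "W \<noteq> {}" for W
  proof -
    obtain U where U: "U \<in> W" using W(2) by blast
    then have ultra: "is_ultrafilter (ends_algebra G) U"
      using openin_subset[OF W(1)] by (auto simp: space_of_ends_def topspace_stone_dual)
    obtain a where a: "a \<in> U" "{V. is_ultrafilter (ends_algebra G) V \<and> a \<in> V} \<subseteq> W"
      using stone_dual_basis W(1) U unfolding space_of_ends_def by blast
    obtain A where A: "A \<in> left_commensurated G" "a = mod_finite G `` {A}"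
      using E.filter_mem_cls[OF E.ultrafilter_order_filter[OF ultra] a(1)] .
    then have "infinite A" using E.ultrafilter_null[OF ultra A(1)] a(1) by blast
    then obtain B where B: "B \<in> \<B>" "B \<subseteq> A" using below A(1) by blast
    have "u B \<in> W" using a(2) u(1)[OF B(1)] u(2)[OF B(1) A(1) B(2)] A(2) by auto
    with B(1) show ?thesis by blast
  qed
  then have "space_of_ends G closure_of (u ` \<B>) = topspace (space_of_ends G)"
    unfolding dense_intersects_open by blast
  moreover have "u ` \<B> \<subseteq> topspace (space_of_ends G)"
    using u(1) by (auto simp: space_of_ends_def topspace_stone_dual)
  ultimately show ?thesis
    unfolding separable_space_def using cnt countable_image by blast
qed

text \<open>
  The edge boundary of \<open>A\<close> in the Schreier graph of left multiplication by \<open>S\<close>, with edges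
  encoded by their label and their source.
\<close>

definition left_boundary :: "('a, 'b) monoid_scheme \<Rightarrow> 'a set \<Rightarrow> 'a set \<Rightarrow> ('a \<times> 'a) set" where
  "left_boundary G S A = {(s, x) \<in> S \<times> carrier G. (x \<in> A) \<noteq> (s \<otimes>\<^bsub>G\<^esub> x \<in> A)}"

lemma finite_left_boundary:
  assumes "group G" and S: "S \<subseteq> carrier G" "finite S" and A: "A \<in> left_commensurated G"
  shows "finite (left_boundary G S A)"
proof -
  interpret group G by fact
  have "finite {x \<in> carrier G. (x \<in> A) \<noteq> (s \<otimes>\<^bsub>G\<^esub> x \<in> A)}" if s: "s \<in> S" for s
  proof -
    have sG: "s \<in> carrier G" using s S by blast
    have sub: "A \<subseteq> carrier G" using A by (simp add: left_commensurated_def)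
    have "s <#\<^bsub>G\<^esub> A = (\<lambda>x. s \<otimes>\<^bsub>G\<^esub> x) ` A"
      by (auto simp: l_coset_def)
    then have "x \<in> A \<longleftrightarrow> s \<otimes>\<^bsub>G\<^esub> x \<in> s <#\<^bsub>G\<^esub> A" if "x \<in> carrier G" for x
      using inj_on_image_mem_iff[OF inj_on_cmult[OF sG] that sub] by simp
    then have "(\<lambda>x. s \<otimes>\<^bsub>G\<^esub> x) ` {x \<in> carrier G. (x \<in> A) \<noteq> (s \<otimes>\<^bsub>G\<^esub> x \<in> A)} \<subseteq> sym_diff (s <#\<^bsub>G\<^esub> A) A"
      by auto
    moreover have "finite (sym_diff (s <#\<^bsub>G\<^esub> A) A)"
      using A sG by (simp add: left_commensurated_def)
    moreover have "inj_on (\<lambda>x. s \<otimes>\<^bsub>G\<^esub> x) {x \<in> carrier G. (x \<in> A) \<noteq> (s \<otimes>\<^bsub>G\<^esub> x \<in> A)}"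
      by (rule inj_on_subset[OF inj_on_cmult[OF sG]]) blast
    ultimately show ?thesis by (meson finite_imageD finite_subset)
  qed
  moreover have "left_boundary G S A =
      (\<Union>s\<in>S. Pair s ` {x \<in> carrier G. (x \<in> A) \<noteq> (s \<otimes>\<^bsub>G\<^esub> x \<in> A)})"
    by (auto simp: left_boundary_def)
  ultimately show ?thesis using S(2) by simp
qed

text \<open>
  The coset of \<open>g\<close> is connected in the Schreier graph: a property that is constant along its
  edges is constant on it. This is used for membership in a set without boundary in the coset,
  and for the agreement of two sets with equal boundaries.
\<close>

lemma generate_invariant:
  assumes "group G" and S: "S \<subseteq> carrier G" and g: "g \<in> carrier G" and h: "h \<in> generate G S"
    and inv: "\<And>s x. \<lbrakk>s \<in> S; x \<in> generate G S #>\<^bsub>G\<^esub> g\<rbrakk> \<Longrightarrow> P (s \<otimes>\<^bsub>G\<^esub> x) \<longleftrightarrow> P x"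
  shows "P (h \<otimes>\<^bsub>G\<^esub> g) \<longleftrightarrow> P g"
proof -
  interpret group G by fact
  interpret H: subgroup "generate G S" G by (rule generate_is_subgroup[OF S])
  have coset: "k \<otimes>\<^bsub>G\<^esub> x \<in> generate G S #>\<^bsub>G\<^esub> g"
    if k: "k \<in> generate G S" and x: "x \<in> generate G S #>\<^bsub>G\<^esub> g" for k x
  proof -
    obtain j where "j \<in> generate G S" "x = j \<otimes>\<^bsub>G\<^esub> g" using x by (auto simp: r_coset_def)
    then have "k \<otimes>\<^bsub>G\<^esub> x = (k \<otimes>\<^bsub>G\<^esub> j) \<otimes>\<^bsub>G\<^esub> g" "k \<otimes>\<^bsub>G\<^esub> j \<in> generate G S"
      using k g by (simp_all add: m_assoc)
    then show ?thesis unfolding r_coset_def by blast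
  qed
  have "\<forall>x \<in> generate G S #>\<^bsub>G\<^esub> g. P (h \<otimes>\<^bsub>G\<^esub> x) \<longleftrightarrow> P x"
    using h
  proof induction
    case one
    show ?case using r_coset_subset_G[OF H.subset g] by auto
  next
    case (incl s)
    then show ?case using inv by blast
  next
    case (inv s)
    show ?case
    proof
      fix x assume x: "x \<in> generate G S #>\<^bsub>G\<^esub> g"
      then have xG: "x \<in> carrier G" using r_coset_subset_G[OF H.subset g] by blast
      have "inv\<^bsub>G\<^esub> s \<otimes>\<^bsub>G\<^esub> x \<in> generate G S #>\<^bsub>G\<^esub> g"
        by (rule coset[OF generate.inv[OF inv] x])
      moreover have "s \<otimes>\<^bsub>G\<^esub> (inv\<^bsub>G\<^esub> s \<otimes>\<^bsub>G\<^esub> x) = x"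
        using S inv xG by (simp add: m_assoc[symmetric] subset_iff)
      ultimately show "P (inv\<^bsub>G\<^esub> s \<otimes>\<^bsub>G\<^esub> x) \<longleftrightarrow> P x"
        using assms(5)[OF inv] by metis
    qed
  next
    case (eng h1 h2)
    show ?case
    proof
      fix x assume x: "x \<in> generate G S #>\<^bsub>G\<^esub> g"
      then have xG: "x \<in> carrier G" using r_coset_subset_G[OF H.subset g] by blast
      have "(h1 \<otimes>\<^bsub>G\<^esub> h2) \<otimes>\<^bsub>G\<^esub> x = h1 \<otimes>\<^bsub>G\<^esub> (h2 \<otimes>\<^bsub>G\<^esub> x)"
        using eng.hyps xG by (simp add: m_assoc)
      with eng.IH x coset[OF eng.hyps(2) x] show "P (h1 \<otimes>\<^bsub>G\<^esub> h2 \<otimes>\<^bsub>G\<^esub> x) \<longleftrightarrow> P x"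
        by simp
    qed
  qed
  moreover have "g \<in> generate G S #>\<^bsub>G\<^esub> g"
    using rcos_self[OF g H.subgroup_axioms] .
  ultimately show ?thesis by blast
qed

text \<open>
  If \<open>A\<close> and \<open>B\<close> have the same boundary, then the set where they agree has no boundary; so if they
  agree at \<open>g\<close>, they agree on its coset. The trace is thus a function of a finite subset of a
  countable set and a truth value.
\<close>

lemma countable_coset_traces:
  assumes grp: "group G" and cnt: "countable (carrier G)" and S: "S \<subseteq> carrier G" "finite S"
    and g: "g \<in> carrier G"
  shows "countable ((\<lambda>A. A \<inter> (generate G S #>\<^bsub>G\<^esub> g)) ` left_commensurated G)"
proof -
  interpret group G by fact
  let ?c = "\<lambda>A. (left_boundary G S A, g \<in> A)" and ?t = "\<lambda>A. A \<inter> (generate G S #>\<^bsub>G\<^esub> g)"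
  have "?c ` left_commensurated G \<subseteq> {D. D \<subseteq> S \<times> carrier G \<and> finite D} \<times> UNIV"
    using finite_left_boundary[OF grp S] by (auto simp: left_boundary_def)
  moreover have "countable ({D. D \<subseteq> S \<times> carrier G \<and> finite D} \<times> (UNIV :: bool set))"
    using countable_Collect_finite_subset[of "S \<times> carrier G"] cnt S(2)
    by (simp add: conj_commute countable_finite)
  ultimately have cntc: "countable (?c ` left_commensurated G)" by (rule countable_subset)
  have det: "?t A = ?t B" if "?c A = ?c B" for A B
  proof -
    have "(x \<in> A \<longleftrightarrow> x \<in> B) \<longleftrightarrow> (g \<in> A \<longleftrightarrow> g \<in> B)" if "x \<in> generate G S #>\<^bsub>G\<^esub> g" for x
    proof -
      obtain h where h: "h \<in> generate G S" "x = h \<otimes>\<^bsub>G\<^esub> g" using \<open>x \<in> _\<close> by (auto simp: r_coset_def)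
      have "(s \<otimes>\<^bsub>G\<^esub> x \<in> A \<longleftrightarrow> s \<otimes>\<^bsub>G\<^esub> x \<in> B) \<longleftrightarrow> (x \<in> A \<longleftrightarrow> x \<in> B)"
        if s: "s \<in> S" and x: "x \<in> generate G S #>\<^bsub>G\<^esub> g" for s x
      proof -
        have "x \<in> carrier G"
          using x r_coset_subset_G[OF generate_incl[OF S(1)] g] by blast
        moreover have "(s, x) \<in> left_boundary G S A \<longleftrightarrow> (s, x) \<in> left_boundary G S B"
          using \<open>?c A = ?c B\<close> by simp
        ultimately show ?thesis using s by (auto simp: left_boundary_def)
      qed
      from generate_invariant[OF grp S(1) g h(1), of "\<lambda>x. x \<in> A \<longleftrightarrow> x \<in> B", OF this] h(2)
      show ?thesis by simp
    qed
    then show ?thesis using that by auto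
  qed
  have "?t ` left_commensurated G \<subseteq> (\<lambda>d. ?t (SOME A. ?c A = d)) ` ?c ` left_commensurated G"
  proof
    fix T assume "T \<in> ?t ` left_commensurated G"
    then obtain A where A: "A \<in> left_commensurated G" "T = ?t A" by blast
    have "?c (SOME B. ?c B = ?c A) = ?c A" by (rule someI) (rule refl)
    then have same: "?t (SOME B. ?c B = ?c A) = ?t A" by (rule det)
    show "T \<in> (\<lambda>d. ?t (SOME A. ?c A = d)) ` ?c ` left_commensurated G"
    proof (rule image_eqI[where x = "?c A"])
      show "T = ?t (SOME B. ?c B = ?c A)" using same A(2) by (simp only:)
      show "?c A \<in> ?c ` left_commensurated G" using A(1) by (rule imageI)
    qed
  qed
  then show ?thesis by (rule countable_subset) (rule countable_image[OF cntc])
qed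

text \<open>
  If all traces were finite, then no trace would fill its infinite coset, so every coset that
  meets \<open>A\<close> would contain the source of a boundary edge. As the boundary is finite, \<open>A\<close> would be
  a finite union of finite traces.
\<close>

lemma infinite_coset_trace:
  assumes grp: "group G" and S: "S \<subseteq> carrier G" "finite S" and inf: "infinite (generate G S)"
    and A: "A \<in> left_commensurated G" "infinite A"
  shows "\<exists>g\<in>carrier G. infinite (A \<inter> (generate G S #>\<^bsub>G\<^esub> g))"
proof (rule ccontr)
  assume "\<not> ?thesis"
  then have fin: "finite (A \<inter> (generate G S #>\<^bsub>G\<^esub> g))" if "g \<in> carrier G" for g
    using that by blast
  interpret group G by fact
  interpret H: subgroup "generate G S" G by (rule generate_is_subgroup[OF S(1)])
  have AG: "A \<subseteq> carrier G" using A(1) by (simp add: left_commensurated_def)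
  have "A \<subseteq> (\<Union>(s, y)\<in>left_boundary G S A. A \<inter> (generate G S #>\<^bsub>G\<^esub> y))"
  proof
    fix x assume x: "x \<in> A"
    then have xG: "x \<in> carrier G" using AG by blast
    have "\<exists>s\<in>S. \<exists>y\<in>generate G S #>\<^bsub>G\<^esub> x. (y \<in> A) \<noteq> (s \<otimes>\<^bsub>G\<^esub> y \<in> A)"
    proof (rule ccontr)
      assume "\<not> ?thesis"
      then have "h \<otimes>\<^bsub>G\<^esub> x \<in> A" if "h \<in> generate G S" for h
        using generate_invariant[OF grp S(1) xG that, of "\<lambda>y. y \<in> A"] x by blast
      then have "(\<lambda>h. h \<otimes>\<^bsub>G\<^esub> x) ` generate G S \<subseteq> A \<inter> (generate G S #>\<^bsub>G\<^esub> x)"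
        by (auto simp: r_coset_def)
      moreover have "inj_on (\<lambda>h. h \<otimes>\<^bsub>G\<^esub> x) (generate G S)"
        using xG by (auto intro!: inj_onI)
      ultimately show False using fin[OF xG] inf by (meson finite_imageD finite_subset)
    qed
    then obtain s y where sy: "s \<in> S" "y \<in> generate G S #>\<^bsub>G\<^esub> x" "(y \<in> A) \<noteq> (s \<otimes>\<^bsub>G\<^esub> y \<in> A)"
      by blast
    have yG: "y \<in> carrier G" using sy(2) r_coset_subset_G[OF H.subset xG] by blast
    have "generate G S #>\<^bsub>G\<^esub> x = generate G S #>\<^bsub>G\<^esub> y"
      by (rule repr_independence[OF sy(2) xG H.subgroup_axioms])
    then have "x \<in> generate G S #>\<^bsub>G\<^esub> y"
      using rcos_self[OF xG H.subgroup_axioms] by simp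
    moreover have "(s, y) \<in> left_boundary G S A" using sy yG by (auto simp: left_boundary_def)
    ultimately show "x \<in> (\<Union>(s, y)\<in>left_boundary G S A. A \<inter> (generate G S #>\<^bsub>G\<^esub> y))"
      using x by blast
  qed
  moreover have "finite (\<Union>(s, y)\<in>left_boundary G S A. A \<inter> (generate G S #>\<^bsub>G\<^esub> y))"
    using finite_left_boundary[OF grp S A(1)] fin by (auto simp: left_boundary_def)
  ultimately show False using A(2) finite_subset by blast
qed

proposition separable_if_not_infinite_locally_finite:
  assumes grp: "group G" and cnt: "countable (carrier G)"
    and not: "\<not> (infinite (carrier G) \<and> locally_finite_group G)"
  shows "separable_space (space_of_ends G)"
proof (cases "finite (carrier G)")
  case True
  \<comment> \<open>The space of ends is empty, and the empty family is dense.\<close>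
  have "finite A" if "A \<in> left_commensurated G" for A
    using that True by (auto simp: left_commensurated_def intro: finite_subset)
  then show ?thesis
    by (intro space_of_ends_separable_if_countable_pi_base[OF grp, of "{}"]) auto
next
  case False
  then obtain S where S: "S \<subseteq> carrier G" "finite S" "infinite (generate G S)"
    using not grp by (auto simp: locally_finite_group_def)
  define \<B> where "\<B> = {B \<in> (\<Union>g\<in>carrier G.
    (\<lambda>A. A \<inter> (generate G S #>\<^bsub>G\<^esub> g)) ` left_commensurated G). infinite B}"
  show ?thesis
  proof (rule space_of_ends_separable_if_countable_pi_base[OF grp, of \<B>])
    have "countable (\<Union>g\<in>carrier G. (\<lambda>A. A \<inter> (generate G S #>\<^bsub>G\<^esub> g)) ` left_commensurated G)"
      using cnt countable_coset_traces[OF grp cnt S(1,2)] by (rule countable_UN)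
    then show "countable \<B>"
      by (rule countable_subset[rotated]) (auto simp: \<B>_def)
    show "B \<subseteq> carrier G \<and> infinite B" if "B \<in> \<B>" for B
      using that by (auto simp: \<B>_def left_commensurated_def)
    show "\<exists>B\<in>\<B>. B \<subseteq> A" if A: "A \<in> left_commensurated G" "infinite A" for A
    proof -
      obtain g where "g \<in> carrier G" "infinite (A \<inter> (generate G S #>\<^bsub>G\<^esub> g))"
        using infinite_coset_trace[OF grp S A] by blast
      with A(1) have "A \<inter> (generate G S #>\<^bsub>G\<^esub> g) \<in> \<B>" by (auto simp: \<B>_def)
      then show ?thesis by blast
    qed
  qed
qed


section \<open>The equivalence\<close>

theorem theorem1p15:
  fixes G :: "('a, 'b) monoid_scheme"
  assumes "group G" and "countable (carrier G)"
  defines "E \<equiv> space_of_ends G"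
  defines "s1 \<equiv> infinite (carrier G) \<and> locally_finite_group G"
    and "s2 \<equiv> (\<exists>f. continuous_map E stone_cech_boundary_nat f \<and>
                   f ` topspace E = topspace stone_cech_boundary_nat)"
    and "s3 \<equiv> (\<exists>\<F>. cellular_family E \<F> \<and> |\<F>| =o ctwo ^c natLeq)"
    and "s4 \<equiv> \<not> countable_cellularity E"
    and "s5 \<equiv> \<not> separable_space E"
  shows "(s1 \<longleftrightarrow> s2) \<and> (s2 \<longleftrightarrow> s3) \<and> (s3 \<longleftrightarrow> s4) \<and> (s4 \<longleftrightarrow> s5)"
proof -
  have "s1 \<Longrightarrow> s2"
    using locally_finite_ends_onto_boundary[OF _ assms(2)] unfolding s1_def s2_def E_def by blast
  moreover have "s2 \<Longrightarrow> s3"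
    using onto_boundary_imp_continuum_cellular_family[of E] unfolding s2_def s3_def by blast
  moreover have "s3 \<Longrightarrow> s4"
    using continuum_cellular_family_imp_not_countable_cellularity[of E] unfolding s3_def s4_def by blast
  moreover have "s4 \<Longrightarrow> s5"
    using separable_imp_countable_cellularity[of E] unfolding s4_def s5_def by blast
  moreover have "s5 \<Longrightarrow> s1"
    using separable_if_not_infinite_locally_finite[OF assms(1,2)] unfolding s5_def s1_def E_def by blast
  ultimately show ?thesis by blast
qed

end
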